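(* Let $A\in\mathbb{R}^{n\times n}$ be symmetric and let $$A\widehat Q_j=\widehat Q_j\widehat T_j+\widehat q_{i+1}\widehat b_j^{\mathsf T}+\widehat F_j$$ be a numerically stable Krylov-like decomposition with unit roundoff $\mathbf{u}$. Then there is a matrix $[Q_j,q_{i+1}]$ with orthonormal columns ($Q_j\in\mathbb{R}^{n\times j}$, $q_{i+1}\in\mathbb{R}^n$) and a matrix $E\in\mathbb{R}^{n\times n}$ such that $$[\widehat Q_j,\widehat q_{i+1}]-[Q_j,q_{i+1}]=\mathcal{O}(\mathbf{u}),\qquad E=\mathcal{O}(\|A\|\mathbf{u}),$$ and $$(A+E)Q_j=Q_j\widehat T_j+q_{i+1}\widehat b_j^{\mathsf T}+F_j,$$ for some $F_j\in\mathbb{R}^{n\times j}$ with $[Q_j,q_{i+1}]^{\mathsf T}F_j=0$ and $\widehat F_j-F_j=\mathcal{O}(\|A\|\mathbf{u})$.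
   Context: $\|\cdot\|$ is the Euclidean norm of a vector or spectral norm of a matrix; $\mathbf{u}>0$ is the unit roundoff. Notation $\mathcal{O}(\cdot)$: $X=\mathcal{O}(\phi)$ means $\|X\|\le c(n)\,\phi$ with a constant $c(n)$ depending only on $n$ and growing at most polynomially with $n$. Thus the theorem asserts: if the hypotheses hold with a constant $c(n)$ of this type, then the conclusions hold with a constant $c'(n)$ of this type (determined by $c$), under the usual convention that $\mathbf{u}$ is small enough, say $c(n)\mathbf{u}\le 1/2$. Numerically stable Krylov-like decomposition: matrices $\widehat Q_j\in\mathbb{R}^{n\times j}$, $\widehat T_j\in\mathbb{R}^{j\times j}$, $\widehat F_j\in\mathbb{R}^{n\times j}$ and vectors $\widehat q_{i+1}\in\mathbb{R}^n$, $\widehat b_j\in\mathbb{R}^j$ satisfying $A\widehat Q_j=\widehat Q_j\widehat T_j+\widehat q_{i+1}\widehat b_j^{\mathsf T}+\widehat F_j$, such that $\widehat T_j$ is symmetric, $\widehat b_j=\widehat Q_j^{\mathsf T}A\widehat q_{i+1}$, and, with $\widehat Q_{j+1}=[\widehat Q_j,\widehat q_{i+1}]$, $$\widehat Q_{j+1}^{\mathsf T}\widehat Q_{j+1}-I=\mathcal{O}(\mathbf{u}),\qquad \widehat Q_{j+1}^{\mathsf T}\widehat F_j=\mathcal{O}(\|A\|\mathbf{u}),\qquad \widehat b_j=\mathcal{O}(\|A\|).$$ *)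

theory Defs
  imports "Jordan_Normal_Form.Matrix" "HOL-Library.Landau_Symbols"
begin

definition euclid_norm :: "real vec \<Rightarrow> real" where
  "euclid_norm v = sqrt (scalar_prod v v)"

text \<open>The ball condition (rather than the unit sphere) keeps the set below nonempty also when
  \<open>M\<close> has no columns; the set is always bounded, so the supremum is a genuine one.\<close>

definition spectral_norm :: "real mat \<Rightarrow> real" where
  "spectral_norm M =
     Sup {euclid_norm (M *\<^sub>v x) | x. x \<in> carrier_vec (dim_col M) \<and> euclid_norm x \<le> 1}"

definition append_col :: "real mat \<Rightarrow> real vec \<Rightarrow> real mat" where
  "append_col Q q = mat_of_cols (dim_row Q) (cols Q @ [q])"

definition outer_product :: "real vec \<Rightarrow> real vec \<Rightarrow> real mat" where
  "outer_product v w = mat (dim_vec v) (dim_vec w) (\<lambda>(r, s). v $ r * w $ s)"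

definition orthonormal_columns :: "real mat \<Rightarrow> bool" where
  "orthonormal_columns Q \<longleftrightarrow>
     (\<forall>r < dim_col Q. \<forall>s < dim_col Q.
        scalar_prod (col Q r) (col Q s) = (if r = s then 1 else 0))"

definition polynomial_growth :: "(nat \<Rightarrow> real) \<Rightarrow> bool" where
  "polynomial_growth c \<longleftrightarrow> (\<exists>k. c \<in> O(\<lambda>n. real n ^ k))"

text \<open>Each condition \<open>X = O(\<phi>)\<close> is rendered by the bound \<open>\<parallel>X\<parallel> \<le> c n * \<phi>\<close>, where the function
  \<open>c\<close> is an explicit parameter. Thus \<open>c\<close> can be chosen before the dimensions, the matrices and
  the unit roundoff \<open>u\<close>, and its polynomial growth can be required separately.
  The arguments \<open>Q, T, q, b, F\<close> are the computed quantities.\<close>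

definition stable_krylov_like ::
  "(nat \<Rightarrow> real) \<Rightarrow> real \<Rightarrow> nat \<Rightarrow> nat \<Rightarrow> real mat \<Rightarrow>
   real mat \<Rightarrow> real mat \<Rightarrow> real vec \<Rightarrow> real vec \<Rightarrow> real mat \<Rightarrow> bool" where
  "stable_krylov_like c u n j A Q T q b F \<longleftrightarrow>
     A \<in> carrier_mat n n \<and> Q \<in> carrier_mat n j \<and> T \<in> carrier_mat j j \<and>
     q \<in> carrier_vec n \<and> b \<in> carrier_vec j \<and> F \<in> carrier_mat n j \<and>
     A * Q = Q * T + outer_product q b + F \<and>
     transpose_mat T = T \<and>
     b = transpose_mat Q *\<^sub>v (A *\<^sub>v q) \<and>
     spectral_norm (transpose_mat (append_col Q q) * append_col Q q - 1\<^sub>m (j + 1)) \<le> c n * u \<and>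
     spectral_norm (transpose_mat (append_col Q q) * F) \<le> c n * (spectral_norm A * u) \<and>
     euclid_norm b \<le> c n * spectral_norm A"

end

(*
  A Gram-Schmidt factorization of W = [Qh, qh] into an orthonormal V moves the columns by a
  multiple of norm (W^T W - I): if v_i = W s_i with s_i supported on the first i indices, then
  <w_k, v_i> - s_i(k) is the k-th entry of (W^T W - I) s_i, so the triangular factor V^T W is
  entrywise close to I.

  With B = [Th; bh^T] the decomposition reads A Qh = W B + Fh.  Multiplying by W^T bounds B, hence
  Fh, by a multiple of norm A, and V^T Fh is small because W^T Fh is.  Taking
  F = Fh - V V^T Fh, the equation for V holds up to a small residual K, which E = - K Q^T absorbs.
  Constants polynomial in n are immaterial, so all estimates can be carried out entrywise.
*)

theory Submission
  imports Defs "HOL-Analysis.L2_Norm"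
begin

section \<open>Gram-Schmidt orthonormalization of nearly orthonormal columns\<close>

text \<open>Induction on the number of processed columns; \<open>w p r\<close> is entry
  \<open>r\<close> of column \<open>p\<close>. The coefficients \<open>s\<close> are carried along
  because they express \<open>v\<close> through \<open>w\<close>, so that closeness can later be
  read off from the Gram matrix. Their positive diagonal fixes the signs: without it
  \<open>v i\<close> could lie near the negative of \<open>w i\<close>.\<close>

lemma gram_schmidt_columns:
  fixes w :: "nat \<Rightarrow> nat \<Rightarrow> real"
  assumes indep: "\<forall>x. (\<forall>r<n. (\<Sum>p<m. w p r * x p) = 0) \<longrightarrow> (\<forall>p<m. x p = 0)"
  shows "k \<le> m \<Longrightarrow> \<exists>v s.
    (\<forall>i<k. \<forall>l<k. (\<Sum>r<n. v i r * v l r) = (if i = l then 1 else 0)) \<and>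
    (\<forall>i<k. \<forall>r<n. v i r = (\<Sum>p<m. w p r * s i p)) \<and>
    (\<forall>i<k. s i i > 0 \<and> (\<forall>p>i. s i p = 0)) \<and>
    (\<forall>l<k. \<forall>r<n. w l r = (\<Sum>i\<le>l. (\<Sum>r<n. v i r * w l r) * v i r))"
    (is "_ \<Longrightarrow> \<exists>v s. ?orth k v \<and> ?comb k v s \<and> ?tri k s \<and> ?span k v")
proof (induction k)
  case 0
  show ?case by simp
next
  case (Suc k)
  from Suc.IH[OF Suc_leD[OF Suc.prems]]
  obtain v s where *: "?orth k v" "?comb k v s" "?tri k s" "?span k v" by blast
  note orth = *(1)[rule_format] and vs = *(2)[rule_format] and span = *(4)[rule_format]
  have spos: "s i i > 0" if "i < k" for i using *(3) that by blast
  have szero: "s i p = 0" if "i < k" "i < p" for i p using *(3) that by blast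
  have km: "k < m" using Suc.prems by simp
  \<comment> \<open>\<open>u\<close> is the residual of column \<open>k\<close> after removing its
    components along the earlier \<open>v i\<close>. \<open>t\<close> holds the coefficients of
    \<open>u\<close> over the columns of \<open>w\<close>: 1 at \<open>k\<close> and 0
    beyond.\<close>
  define a where "a i = (\<Sum>r<n. v i r * w k r)" for i
  define u where "u r = w k r - (\<Sum>i<k. a i * v i r)" for r
  define t where "t p = (if p = k then 1 else 0) - (\<Sum>i<k. a i * s i p)" for p
  define N where "N = L2_set u {..<n}"
  have ut: "u r = (\<Sum>p<m. w p r * t p)" if "r < n" for r
  proof -
    have "(\<Sum>p<m. w p r * t p) =
        (\<Sum>p<m. w p r * (if p = k then 1 else 0)) - (\<Sum>p<m. \<Sum>i<k. a i * (w p r * s i p))"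
      by (simp add: t_def right_diff_distrib sum_subtractf sum_distrib_left mult.left_commute)
    also have "(\<Sum>p<m. w p r * (if p = k then 1 else 0)) = w k r"
      using km by (simp add: if_distrib cong: if_cong)
    also have "(\<Sum>p<m. \<Sum>i<k. a i * (w p r * s i p)) = (\<Sum>i<k. a i * v i r)"
      using that by (subst sum.swap) (simp add: vs sum_distrib_left)
    finally show ?thesis by (simp add: u_def)
  qed
  have tk: "t k = 1" using szero by (simp add: t_def)
  have tz: "t p = 0" if "p > k" for p using that szero by (simp add: t_def)
  \<comment> \<open>A zero residual would be a vanishing combination of the columns with coefficient
    \<open>t k = 1\<close>, against independence.\<close>
  have "N \<noteq> 0"
  proof
    assume "N = 0"
    then have "\<forall>r<n. u r = 0" by (simp add: N_def L2_set_eq_0_iff)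
    then have "t k = 0" using indep[rule_format, of t k] km ut by simp
    then show False using tk by simp
  qed
  then have Npos: "N > 0" using L2_set_nonneg[of u "{..<n}"] unfolding N_def by linarith
  have vu: "(\<Sum>r<n. v l r * u r) = 0" if "l < k" for l
  proof -
    have "(\<Sum>r<n. v l r * u r) = a l - (\<Sum>r<n. \<Sum>i<k. a i * (v l r * v i r))"
      by (simp add: u_def a_def right_diff_distrib sum_subtractf sum_distrib_left mult.left_commute)
    also have "(\<Sum>r<n. \<Sum>i<k. a i * (v l r * v i r)) = (\<Sum>i<k. a i * (if l = i then 1 else 0))"
      using that by (subst sum.swap) (simp add: orth flip: sum_distrib_left)
    also have "\<dots> = a l" using that by (simp add: if_distrib cong: if_cong)
    finally show ?thesis by simp
  qed
  have uu: "(\<Sum>r<n. u r * u r) = N * N"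
    by (simp add: N_def L2_set_def power2_eq_square sum_nonneg)
  define v' where "v' = v(k := \<lambda>r. u r / N)"
  define s' where "s' = s(k := \<lambda>p. t p / N)"
  \<comment> \<open>Since \<open>u\<close> is orthogonal to the earlier \<open>v i\<close>, pairing
    it with \<open>w k\<close> equals pairing it with itself. Hence the new expansion coefficient of
    \<open>w k\<close> is \<open>N\<close>, and its term restores \<open>u\<close>.\<close>
  have uw: "(\<Sum>r<n. u r * w k r) = N * N"
  proof -
    have "N * N = (\<Sum>r<n. u r * w k r) - (\<Sum>r<n. \<Sum>i<k. a i * (v i r * u r))"
      unfolding uu[symmetric]
      by (subst (2) u_def)
        (simp add: right_diff_distrib sum_subtractf sum_distrib_left mult.left_commute mult.commute)
    also have "(\<Sum>r<n. \<Sum>i<k. a i * (v i r * u r)) = 0"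
      by (subst sum.swap) (simp add: vu flip: sum_distrib_left)
    finally show ?thesis by simp
  qed
  have "(\<Sum>r<n. v' i r * v' l r) = (if i = l then 1 else 0)" if "i < Suc k" "l < Suc k" for i l
    using that orth[of i l] vu[of i] vu[of l] uu Npos
    by (auto simp: v'_def less_Suc_eq mult.commute simp flip: sum_divide_distrib)
  moreover have "v' i r = (\<Sum>p<m. w p r * s' i p)" if "i < Suc k" "r < n" for i r
    using that vs[of i r] ut[of r] by (auto simp: v'_def s'_def less_Suc_eq simp flip: sum_divide_distrib)
  moreover have "s' i i > 0 \<and> (\<forall>p>i. s' i p = 0)" if "i < Suc k" for i
    using that spos[of i] szero[of i] tk tz Npos by (auto simp: s'_def less_Suc_eq)
  moreover have "w l r = (\<Sum>i\<le>l. (\<Sum>r<n. v' i r * w l r) * v' i r)" if "l < Suc k" "r < n" for l r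
  proof (cases "l = k")
    case True
    have "(\<Sum>i\<le>k. (\<Sum>r<n. v' i r * w k r) * v' i r) = (\<Sum>i<k. a i * v i r) + u r"
      using uw Npos
      by (simp add: v'_def a_def flip: lessThan_Suc_atMost sum_divide_distrib)
    then show ?thesis using True by (simp add: u_def)
  next
    case False
    then have "l < k" using that by simp
    then show ?thesis using span[of l r] that by (simp add: v'_def)
  qed
  ultimately show ?case by blast
qed

lemma orthonormal_entry_le:
  fixes v :: "nat \<Rightarrow> nat \<Rightarrow> real"
  assumes orth: "\<And>i l. i < m \<Longrightarrow> l < m \<Longrightarrow> (\<Sum>r<n. v i r * v l r) = (if i = l then 1 else 0)"
    and "i < m" "r < n"
  shows "\<bar>v i r\<bar> \<le> 1"
proof -
  have "(v i r)\<^sup>2 \<le> (\<Sum>r<n. (v i r)\<^sup>2)"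
    by (rule member_le_sum[where f = "\<lambda>r. (v i r)\<^sup>2"]) (use assms in auto)
  also have "\<dots> = 1" using orth[of i i] assms by (simp add: power2_eq_square)
  finally show ?thesis by (simp add: abs_square_le_1)
qed

text \<open>Counts the sum of all squared entries twice: each of the \<open>m\<close> columns
  contributes 1, and each of the \<open>n\<close> rows at most 1 by Bessel's inequality.\<close>

lemma orthonormal_card_le:
  fixes v :: "nat \<Rightarrow> nat \<Rightarrow> real"
  assumes orth: "\<And>i l. i < m \<Longrightarrow> l < m \<Longrightarrow> (\<Sum>r<n. v i r * v l r) = (if i = l then 1 else 0)"
  shows "m \<le> n"
proof -
  have bessel: "(\<Sum>i<m. v i r * v i r) \<le> 1" if "r < n" for r
  proof -
    \<comment> \<open>\<open>z\<close> is the projection of the \<open>r\<close>-th unit vector onto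
      the span of the columns, so its squared length equals its own entry \<open>z r\<close>; this
      forces \<open>z r\<close> to be at most 1.\<close>
    define z where "z r' = (\<Sum>i<m. v i r * v i r')" for r'
    have "(\<Sum>r'<n. z r' * z r') = (\<Sum>r'<n. \<Sum>i<m. \<Sum>l<m. v i r * (v l r * (v i r' * v l r')))"
      by (simp add: z_def sum_product mult_ac)
    also have "\<dots> = (\<Sum>i<m. \<Sum>l<m. \<Sum>r'<n. v i r * (v l r * (v i r' * v l r')))"
      by (subst sum.swap, rule sum.cong[OF refl], subst sum.swap, rule refl)
    also have "\<dots> = (\<Sum>i<m. \<Sum>l<m. v i r * (v l r * (if i = l then 1 else 0)))"
      by (simp add: orth flip: sum_distrib_left)
    also have "\<dots> = z r"
      by (simp add: z_def if_distrib cong: if_cong)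
    finally have "(\<Sum>r'<n. z r' * z r') = z r" .
    moreover have "z r * z r \<le> (\<Sum>r'<n. z r' * z r')"
      by (rule member_le_sum[where f = "\<lambda>r. z r * z r"]) (use that in auto)
    ultimately have "z r * z r \<le> z r" by simp
    then have "z r \<le> 1"
      using mult_strict_left_mono[of 1 "z r" "z r"] by fastforce
    then show ?thesis by (simp add: z_def)
  qed
  have "real m = (\<Sum>i<m. \<Sum>r<n. v i r * v i r)" by (simp add: orth)
  also have "\<dots> = (\<Sum>r<n. \<Sum>i<m. v i r * v i r)" by (rule sum.swap)
  also have "\<dots> \<le> (\<Sum>r<n. 1)" by (rule sum_mono) (use bessel in auto)
  finally show ?thesis by simp
qed

text \<open>In matrix form W = V R and W - V = V (R - I), so it suffices that the triangular
  \<open>R\<close> is entrywise within \<open>2 * d\<close> of the identity. Above the diagonal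
  \<open>R\<close> is the Gram defect \<open>D\<close> applied to \<open>s i\<close>. On the
  diagonal \<open>R\<close> and \<open>s\<close> are reciprocal, which turns a bound on their
  difference into one on \<open>R i i - 1\<close>. The bound on \<open>d\<close> keeps the smallest
  singular value of W away from 0, which yields both independence and bounded
  \<open>s\<close>.\<close>

lemma near_orthonormal_columns:
  fixes w :: "nat \<Rightarrow> nat \<Rightarrow> real" and n m :: nat
  defines "G \<equiv> \<lambda>k p. (\<Sum>r<n. w k r * w p r)"
  defines "D \<equiv> \<lambda>k p. G k p - (if k = p then 1 else 0)"
  assumes near: "\<And>x. L2_set (\<lambda>k. \<Sum>p<m. D k p * x p) {..<m} \<le> d * L2_set x {..<m}"
    and d: "d \<le> 1 / 2"
  obtains v where
    "\<And>i l. i < m \<Longrightarrow> l < m \<Longrightarrow> (\<Sum>r<n. v i r * v l r) = (if i = l then 1 else 0)"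
    "\<And>k r. k < m \<Longrightarrow> r < n \<Longrightarrow> \<bar>w k r - v k r\<bar> \<le> 2 * real m * d"
proof -
  have Gx: "(\<Sum>p<m. G k p * x p) = x k + (\<Sum>p<m. D k p * x p)" if "k < m" for k x
  proof -
    have "(\<Sum>p<m. G k p * x p) = (\<Sum>p<m. (if k = p then x p else 0) + D k p * x p)"
      by (rule sum.cong) (auto simp: D_def algebra_simps)
    also have "\<dots> = x k + (\<Sum>p<m. D k p * x p)"
      using that by (simp add: sum.distrib)
    finally show ?thesis .
  qed
  have quad: "(\<Sum>r<n. (\<Sum>p<m. w p r * x p)\<^sup>2) = (\<Sum>k<m. x k * (\<Sum>p<m. G k p * x p))" for x
  proof -
    have "(\<Sum>r<n. (\<Sum>p<m. w p r * x p)\<^sup>2) = (\<Sum>r<n. \<Sum>k<m. \<Sum>p<m. x k * (w k r * w p r * x p))"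
      by (simp add: power2_eq_square sum_product mult_ac)
    also have "\<dots> = (\<Sum>k<m. \<Sum>p<m. \<Sum>r<n. x k * (w k r * w p r * x p))"
      by (subst sum.swap, rule sum.cong[OF refl], subst sum.swap, rule refl)
    also have "\<dots> = (\<Sum>k<m. x k * (\<Sum>p<m. G k p * x p))"
      by (simp add: G_def sum_distrib_right flip: sum_distrib_left)
    finally show ?thesis .
  qed
  \<comment> \<open>The quadratic form of \<open>G\<close> is the squared norm of \<open>x\<close>
    plus the form of \<open>D\<close>, and by Cauchy-Schwarz with \<open>d \<le> 1 / 2\<close> the
    latter takes away at most half.\<close>
  have lower: "(\<Sum>k<m. (x k)\<^sup>2) \<le> 2 * (\<Sum>r<n. (\<Sum>p<m. w p r * x p)\<^sup>2)" for x
  proof -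
    have "\<bar>\<Sum>k<m. x k * (\<Sum>p<m. D k p * x p)\<bar> \<le> (\<Sum>k<m. \<bar>x k\<bar> * \<bar>\<Sum>p<m. D k p * x p\<bar>)"
      by (rule order_trans[OF sum_abs]) (simp add: abs_mult)
    also have "\<dots> \<le> L2_set x {..<m} * L2_set (\<lambda>k. \<Sum>p<m. D k p * x p) {..<m}"
      by (rule L2_set_mult_ineq)
    also have "\<dots> \<le> L2_set x {..<m} * (1 / 2 * L2_set x {..<m})"
      by (intro mult_left_mono order_trans[OF near] mult_right_mono d) auto
    also have "\<dots> = (\<Sum>k<m. (x k)\<^sup>2) / 2"
      by (simp add: L2_set_def sum_nonneg)
    finally have *: "\<bar>\<Sum>k<m. x k * (\<Sum>p<m. D k p * x p)\<bar> \<le> (\<Sum>k<m. (x k)\<^sup>2) / 2" .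
    have "(\<Sum>r<n. (\<Sum>p<m. w p r * x p)\<^sup>2) = (\<Sum>k<m. (x k)\<^sup>2) + (\<Sum>k<m. x k * (\<Sum>p<m. D k p * x p))"
      unfolding quad by (simp add: Gx distrib_left sum.distrib power2_eq_square)
    with * show ?thesis by linarith
  qed
  have indep: "\<forall>x. (\<forall>r<n. (\<Sum>p<m. w p r * x p) = 0) \<longrightarrow> (\<forall>p<m. x p = 0)"
  proof (intro allI impI)
    fix x p assume that: "\<forall>r<n. (\<Sum>p<m. w p r * x p) = 0" "p < m"
    have "(\<Sum>k<m. (x k)\<^sup>2) \<le> 0" using lower[of x] that by simp
    then have "(\<Sum>k<m. (x k)\<^sup>2) = 0" by (simp add: sum_nonneg order_antisym)
    then show "x p = 0" using that by (simp add: sum_nonneg_eq_0_iff)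
  qed
  obtain v s where *:
    "\<forall>i<m. \<forall>l<m. (\<Sum>r<n. v i r * v l r) = (if i = l then 1 else 0)"
    "\<forall>i<m. \<forall>r<n. v i r = (\<Sum>p<m. w p r * s i p)"
    "\<forall>i<m. s i i > 0 \<and> (\<forall>p>i. s i p = 0)"
    "\<forall>l<m. \<forall>r<n. w l r = (\<Sum>i\<le>l. (\<Sum>r<n. v i r * w l r) * v i r)"
    using gram_schmidt_columns[where n = n and m = m and w = w, OF indep order_refl] by blast
  note orth = *(1)[rule_format] and vs = *(2)[rule_format] and span = *(4)[rule_format]
  have spos: "s i i > 0" if "i < m" for i using *(3) that by blast
  have szero: "s i p = 0" if "i < m" "i < p" for i p using *(3) that by blast
  define R where "R i l = (\<Sum>r<n. v i r * w l r)" for i l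
  have Rs: "R i l = s i l + (\<Sum>p<m. D l p * s i p)" if "i < m" "l < m" for i l
  proof -
    have "R i l = (\<Sum>r<n. \<Sum>p<m. w l r * w p r * s i p)"
      using that by (simp add: R_def vs sum_distrib_left sum_distrib_right mult_ac)
    also have "\<dots> = (\<Sum>p<m. G l p * s i p)"
      by (subst sum.swap) (simp add: G_def sum_distrib_right)
    finally show ?thesis using Gx that by simp
  qed
  have Rzero: "R i l = 0" if "l < i" "i < m" for i l
  proof -
    have lm: "l < m" using that by simp
    have wR: "w l r = (\<Sum>k\<le>l. R k l * v k r)" if "r < n" for r
      unfolding R_def by (rule span[OF lm that])
    have "R i l = (\<Sum>r<n. v i r * (\<Sum>k\<le>l. R k l * v k r))"
      unfolding R_def[of i l] by (rule sum.cong[OF refl]) (simp add: wR)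
    also have "\<dots> = (\<Sum>r<n. \<Sum>k\<le>l. v i r * (R k l * v k r))"
      by (simp add: sum_distrib_left)
    also have "\<dots> = (\<Sum>k\<le>l. \<Sum>r<n. R k l * (v i r * v k r))"
      by (subst sum.swap) (simp add: mult_ac)
    also have "\<dots> = (\<Sum>k\<le>l. R k l * (if i = k then 1 else 0))"
      using that by (simp add: orth flip: sum_distrib_left)
    also have "\<dots> = 0" using that by (intro sum.neutral) auto
    finally show ?thesis .
  qed
  \<comment> \<open>When \<open>v i\<close> is paired with its own expansion over \<open>w\<close>,
    \<open>s i p\<close> vanishes for \<open>p > i\<close> and \<open>R i p\<close> for
    \<open>p < i\<close>, so only the product of the two diagonal entries survives.\<close>
  have Rdiag: "R i i * s i i = 1" if "i < m" for i
  proof -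
    have vv: "v i r * v i r = (\<Sum>p<m. s i p * (v i r * w p r))" if "r < n" for r
    proof -
      have "v i r * v i r = v i r * (\<Sum>p<m. w p r * s i p)"
        by (subst (2) vs) (use \<open>i < m\<close> that in simp_all)
      then show ?thesis by (simp add: sum_distrib_left mult_ac)
    qed
    have "1 = (\<Sum>r<n. v i r * v i r)" using orth that by simp
    also have "\<dots> = (\<Sum>r<n. \<Sum>p<m. s i p * (v i r * w p r))"
      by (rule sum.cong[OF refl]) (simp add: vv)
    also have "\<dots> = (\<Sum>p<m. s i p * R i p)"
      by (subst sum.swap) (simp add: R_def sum_distrib_left)
    also have "\<dots> = (\<Sum>p<m. if p = i then s i i * R i i else 0)"
      by (rule sum.cong) (use that Rzero szero in \<open>auto simp: neq_iff\<close>)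
    also have "\<dots> = s i i * R i i" using that by simp
    finally show ?thesis by (simp add: mult.commute)
  qed
  \<comment> \<open>The combination with coefficients \<open>s i\<close> is the unit vector
    \<open>v i\<close>, so \<open>lower\<close> gives squared norm at most 2; its square root is
    rounded up to 2.\<close>
  have snorm: "L2_set (s i) {..<m} \<le> 2" if "i < m" for i
  proof -
    have "(\<Sum>r<n. (\<Sum>p<m. w p r * s i p)\<^sup>2) = (\<Sum>r<n. v i r * v i r)"
      using that by (simp add: vs power2_eq_square)
    then have "(\<Sum>k<m. (s i k)\<^sup>2) \<le> 2" using lower[of "s i"] orth that by simp
    then show ?thesis unfolding L2_set_def by (intro real_le_lsqrt) (auto intro: sum_nonneg)
  qed
  \<comment> \<open>The sign of \<open>d\<close> follows from \<open>near\<close> tested on the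
    vector of ones, which is nonzero as soon as there is a column.\<close>
  have d0: "d \<ge> 0" if "m > 0"
  proof -
    have "L2_set (\<lambda>k. 1::real) {..<m} > 0" using that by (simp add: L2_set_constant)
    moreover have "0 \<le> d * L2_set (\<lambda>k. 1::real) {..<m}"
      using order_trans[OF L2_set_nonneg near] .
    ultimately show ?thesis by (simp add: zero_le_mult_iff)
  qed
  have Ds: "\<bar>\<Sum>p<m. D l p * s i p\<bar> \<le> 2 * d" if "i < m" "l < m" for i l
  proof -
    have "\<bar>\<Sum>p<m. D l p * s i p\<bar> \<le> L2_set (\<lambda>k. \<bar>\<Sum>p<m. D k p * s i p\<bar>) {..<m}"
      by (rule member_le_L2_set) (use that in auto)
    also have "\<dots> = L2_set (\<lambda>k. \<Sum>p<m. D k p * s i p) {..<m}" by (simp add: L2_set_def)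
    also have "\<dots> \<le> d * L2_set (s i) {..<m}" by (rule near)
    also have "\<dots> \<le> d * 2" using that d0 snorm by (intro mult_left_mono) auto
    finally show ?thesis by simp
  qed
  have Rbound: "\<bar>R i l - (if i = l then 1 else 0)\<bar> \<le> 2 * d" if "i \<le> l" "l < m" for i l
  proof (cases "i = l")
    case False
    then show ?thesis using that Rs[of i l] szero[of i l] Ds[of i l] by simp
  next
    case True
    define \<rho> where "\<rho> = R l l"
    define \<sigma> where "\<sigma> = s l l"
    have *: "\<rho> * \<sigma> = 1" "\<sigma> > 0" using Rdiag spos that by (auto simp: \<rho>_def \<sigma>_def)
    \<comment> \<open>The number 1 lies between the positive reciprocals \<open>\<rho>\<close> and
      \<open>\<sigma>\<close>, so it is no farther from \<open>\<rho>\<close> than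
      \<open>\<sigma>\<close> is.\<close>
    have "\<bar>\<rho> - 1\<bar> \<le> \<bar>\<rho> - \<sigma>\<bar>"
    proof (cases "\<rho> \<ge> 1")
      case True
      then have "\<sigma> \<le> 1" using * mult_right_mono[of 1 \<rho> \<sigma>] by simp
      then show ?thesis using True by simp
    next
      case False
      then have "\<sigma> \<ge> 1" using * mult_right_mono[of \<rho> 1 \<sigma>] by simp
      then show ?thesis using False by simp
    qed
    also have "\<dots> \<le> 2 * d" using that Rs[of l l] Ds[of l l] by (simp add: \<rho>_def \<sigma>_def)
    finally show ?thesis using True by (simp add: \<rho>_def)
  qed
  show thesis
  proof (rule that)
    fix k r assume k: "k < m" and r: "r < n"
    have "(\<Sum>i\<le>k. (if i = k then 1 else 0) * v i r) = (\<Sum>i\<le>k. if i = k then v i r else 0)"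
      by (rule sum.cong) auto
    then have vk: "v k r = (\<Sum>i\<le>k. (if i = k then 1 else 0) * v i r)" by simp
    have "w k r - v k r = (\<Sum>i\<le>k. R i k * v i r) - (\<Sum>i\<le>k. (if i = k then 1 else 0) * v i r)"
      unfolding R_def vk[symmetric] by (simp only: span[OF k r, symmetric])
    also have "\<dots> = (\<Sum>i\<le>k. (R i k - (if i = k then 1 else 0)) * v i r)"
      by (simp only: left_diff_distrib sum_subtractf)
    finally have "\<bar>w k r - v k r\<bar> = \<bar>\<Sum>i\<le>k. (R i k - (if i = k then 1 else 0)) * v i r\<bar>" by simp
    also have "\<dots> \<le> (\<Sum>i\<le>k. \<bar>R i k - (if i = k then 1 else 0)\<bar> * \<bar>v i r\<bar>)"
      by (rule order_trans[OF sum_abs]) (simp add: abs_mult)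
    \<comment> \<open>There are at most \<open>m\<close> terms, each an entry of R - I times an
      entry of a unit vector.\<close>
    also have "\<dots> \<le> (\<Sum>i\<le>k. 2 * d * 1)"
    proof (intro sum_mono mult_mono)
      fix i assume "i \<in> {..k}"
      then show "\<bar>v i r\<bar> \<le> 1" using k r by (intro orthonormal_entry_le[OF orth]) auto
      show "\<bar>R i k - (if i = k then 1 else 0)\<bar> \<le> 2 * d" using \<open>i \<in> {..k}\<close> k by (intro Rbound) auto
    qed (use k d0 in auto)
    also have "\<dots> = real (Suc k) * (2 * d)" by simp
    also have "\<dots> \<le> real m * (2 * d)" using k d0 by (intro mult_right_mono) auto
    finally show "\<bar>w k r - v k r\<bar> \<le> 2 * real m * d" by simp
  qed (use orth in auto)
qed

section \<open>Euclidean and spectral norms against entrywise bounds\<close>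

lemma euclid_norm_L2: "euclid_norm v = L2_set (($) v) {..<dim_vec v}"
  by (simp add: euclid_norm_def L2_set_def scalar_prod_def power2_eq_square lessThan_atLeast0)

lemma euclid_norm_smult: "euclid_norm (a \<cdot>\<^sub>v v) = \<bar>a\<bar> * euclid_norm v"
  by (simp add: euclid_norm_L2 L2_set_right_distrib)
    (simp add: L2_set_def power_mult_distrib)

lemma abs_entry_le_euclid_norm:
  assumes "i < dim_vec v"
  shows "\<bar>v $ i\<bar> \<le> euclid_norm v"
proof -
  have "\<bar>v $ i\<bar> \<le> L2_set (\<lambda>i. \<bar>v $ i\<bar>) {..<dim_vec v}"
    by (rule member_le_L2_set) (use assms in auto)
  then show ?thesis by (simp add: euclid_norm_L2 L2_set_def)
qed

lemma euclid_norm_le_entries: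
  assumes "\<And>i. i < dim_vec v \<Longrightarrow> \<bar>v $ i\<bar> \<le> e"
  shows "euclid_norm v \<le> real (dim_vec v) * e"
proof -
  have "euclid_norm v \<le> (\<Sum>i<dim_vec v. \<bar>v $ i\<bar>)"
    unfolding euclid_norm_L2 by (rule L2_set_le_sum_abs)
  also have "\<dots> \<le> (\<Sum>i<dim_vec v. e)" by (rule sum_mono) (use assms in auto)
  finally show ?thesis by simp
qed

text \<open>Entrywise bounds replace norms in the residual estimates: they pass through sums and
  products by the triangle inequality, and going to and from \<open>spectral_norm\<close> costs at
  most the product of the dimensions.\<close>

definition entries_le :: "real mat \<Rightarrow> real \<Rightarrow> bool" where
  "entries_le M e \<longleftrightarrow> (\<forall>i<dim_row M. \<forall>j<dim_col M. \<bar>M $$ (i, j)\<bar> \<le> e)"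

lemma entries_le_mono: "entries_le M a \<Longrightarrow> a \<le> b \<Longrightarrow> entries_le M b"
  by (force simp: entries_le_def)

lemma entries_le_transpose: "entries_le M a \<Longrightarrow> entries_le (transpose_mat M) a"
  by (auto simp: entries_le_def)

lemma entries_le_uminus: "entries_le M a \<Longrightarrow> entries_le (- M) a"
  by (auto simp: entries_le_def)

lemma entries_le_add:
  assumes "M \<in> carrier_mat r s" "M' \<in> carrier_mat r s" "entries_le M a" "entries_le M' b"
  shows "entries_le (M + M') (a + b)"
  using assms by (auto simp: entries_le_def intro!: order_trans[OF abs_triangle_ineq] add_mono)

lemma entries_le_minus:
  assumes "M \<in> carrier_mat r s" "M' \<in> carrier_mat r s" "entries_le M a" "entries_le M' b"
  shows "entries_le (M - M') (a + b)"
  using assms by (auto simp: entries_le_def intro!: order_trans[OF abs_triangle_ineq4] add_mono)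

text \<open>The inner dimension enters only through the upper bound \<open>n\<close>, so that every
  product costs one factor \<open>n\<close> whatever the shapes.\<close>

lemma entries_le_mult:
  assumes "M \<in> carrier_mat r k" "M' \<in> carrier_mat k s" "entries_le M a" "entries_le M' b"
    and "k \<le> n" "0 \<le> a" "0 \<le> b"
  shows "entries_le (M * M') (real n * (a * b))"
  unfolding entries_le_def
proof (intro allI impI)
  fix i j assume "i < dim_row (M * M')" "j < dim_col (M * M')"
  then have ij: "i < r" "j < s" using assms by auto
  have "\<bar>(M * M') $$ (i, j)\<bar> = \<bar>\<Sum>l<k. M $$ (i, l) * M' $$ (l, j)\<bar>"
    using ij assms(1,2) by (simp add: scalar_prod_def lessThan_atLeast0)
  also have "\<dots> \<le> (\<Sum>l<k. \<bar>M $$ (i, l)\<bar> * \<bar>M' $$ (l, j)\<bar>)"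
    by (rule order_trans[OF sum_abs]) (simp add: abs_mult)
  also have "\<dots> \<le> (\<Sum>l<k. a * b)"
    by (intro sum_mono mult_mono) (use assms ij in \<open>auto simp: entries_le_def\<close>)
  also have "\<dots> \<le> real n * (a * b)"
    using assms by (simp add: mult_right_mono)
  finally show "\<bar>(M * M') $$ (i, j)\<bar> \<le> real n * (a * b)" .
qed

lemma euclid_norm_mult_mat_vec_le:
  assumes M: "entries_le M e" and x: "x \<in> carrier_vec (dim_col M)" "euclid_norm x \<le> 1"
  shows "euclid_norm (M *\<^sub>v x) \<le> real (dim_row M) * (real (dim_col M) * e)"
proof -
  have "\<bar>(M *\<^sub>v x) $ i\<bar> \<le> real (dim_col M) * e" if "i < dim_row M" for i
  proof -
    have "\<bar>(M *\<^sub>v x) $ i\<bar> = \<bar>\<Sum>l<dim_col M. M $$ (i, l) * x $ l\<bar>"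
      using that x by (simp add: scalar_prod_def lessThan_atLeast0)
    also have "\<dots> \<le> (\<Sum>l<dim_col M. \<bar>M $$ (i, l)\<bar> * \<bar>x $ l\<bar>)"
      by (rule order_trans[OF sum_abs]) (simp add: abs_mult)
    also have "\<dots> \<le> (\<Sum>l<dim_col M. e * 1)"
    proof (rule sum_mono)
      fix l assume l: "l \<in> {..<dim_col M}"
      have "\<bar>M $$ (i, l)\<bar> \<le> e" using M l that by (simp add: entries_le_def)
      moreover have "\<bar>x $ l\<bar> \<le> 1"
        using l x abs_entry_le_euclid_norm[of l x] by simp
      ultimately show "\<bar>M $$ (i, l)\<bar> * \<bar>x $ l\<bar> \<le> e * 1"
        by (intro mult_mono) auto
    qed
    finally show ?thesis by simp
  qed
  then show ?thesis using euclid_norm_le_entries[of "M *\<^sub>v x"] by simp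
qed

text \<open>A real \<open>Sup\<close> dominates the members of its set only if the set is bounded
  above. The sum of the absolute values of all entries serves as a crude entrywise bound.\<close>

lemma bdd_above_spectral_norm:
  "bdd_above {euclid_norm (M *\<^sub>v x) | x. x \<in> carrier_vec (dim_col M) \<and> euclid_norm x \<le> 1}"
proof -
  define e where "e = (\<Sum>i<dim_row M. \<Sum>j<dim_col M. \<bar>M $$ (i, j)\<bar>)"
  have "\<bar>M $$ (i, j)\<bar> \<le> e" if "i < dim_row M" "j < dim_col M" for i j
  proof -
    have "\<bar>M $$ (i, j)\<bar> \<le> (\<Sum>j<dim_col M. \<bar>M $$ (i, j)\<bar>)"
      by (rule member_le_sum[where f = "\<lambda>j. \<bar>M $$ (i, j)\<bar>"]) (use that in auto)
    also have "\<dots> \<le> e"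
      unfolding e_def
      by (rule member_le_sum[where f = "\<lambda>i. \<Sum>j<dim_col M. \<bar>M $$ (i, j)\<bar>"])
        (use that in \<open>auto intro: sum_nonneg\<close>)
    finally show ?thesis .
  qed
  then have "entries_le M e" by (simp add: entries_le_def)
  then show ?thesis
    by (intro bdd_aboveI[where M = "real (dim_row M) * (real (dim_col M) * e)"])
      (auto intro: euclid_norm_mult_mat_vec_le)
qed

lemma euclid_norm_zero: "euclid_norm (0\<^sub>v n) = 0"
  by (simp add: euclid_norm_def)

lemma spectral_norm_le_entries:
  assumes "entries_le M e"
  shows "spectral_norm M \<le> real (dim_row M) * (real (dim_col M) * e)"
  unfolding spectral_norm_def
proof (rule cSup_least)
  have "0\<^sub>v (dim_col M) \<in> carrier_vec (dim_col M) \<and> euclid_norm (0\<^sub>v (dim_col M)) \<le> 1"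
    by (simp add: euclid_norm_zero)
  then show "{euclid_norm (M *\<^sub>v x) | x. x \<in> carrier_vec (dim_col M) \<and> euclid_norm x \<le> 1} \<noteq> {}"
    by blast
qed (use assms euclid_norm_mult_mat_vec_le in auto)

lemma euclid_norm_le_spectral_norm_unit:
  assumes "x \<in> carrier_vec (dim_col M)" "euclid_norm x \<le> 1"
  shows "euclid_norm (M *\<^sub>v x) \<le> spectral_norm M"
  unfolding spectral_norm_def
  by (rule cSup_upper[OF _ bdd_above_spectral_norm]) (use assms in blast)

lemma spectral_norm_nonneg: "0 \<le> spectral_norm M"
proof -
  have "0 \<le> euclid_norm (M *\<^sub>v 0\<^sub>v (dim_col M))" by (simp add: euclid_norm_L2)
  also have "\<dots> \<le> spectral_norm M"
    by (rule euclid_norm_le_spectral_norm_unit) (simp_all add: euclid_norm_zero)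
  finally show ?thesis .
qed

lemma euclid_norm_mult_mat_vec:
  assumes x: "x \<in> carrier_vec (dim_col M)"
  shows "euclid_norm (M *\<^sub>v x) \<le> spectral_norm M * euclid_norm x"
proof (cases "euclid_norm x = 0")
  case True
  then have "x = 0\<^sub>v (dim_col M)"
    using x by (intro eq_vecI) (auto simp: euclid_norm_L2 L2_set_eq_0_iff)
  moreover have "M *\<^sub>v 0\<^sub>v (dim_col M) = 0\<^sub>v (dim_row M)"
    by (intro eq_vecI) auto
  ultimately show ?thesis by (simp add: euclid_norm_zero)
next
  case False
  define s where "s = euclid_norm x"
  have s: "s > 0" using False L2_set_nonneg[of "($) x"] by (simp add: s_def euclid_norm_L2 less_le)
  have "M *\<^sub>v x = s \<cdot>\<^sub>v (M *\<^sub>v ((1 / s) \<cdot>\<^sub>v x))"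
    using x s by (simp add: mult_mat_vec[of M "dim_row M" "dim_col M" x] smult_smult_assoc)
  then have "euclid_norm (M *\<^sub>v x) = s * euclid_norm (M *\<^sub>v ((1 / s) \<cdot>\<^sub>v x))"
    using s by (metis abs_of_pos euclid_norm_smult)
  also have "\<dots> \<le> s * spectral_norm M"
  proof (rule mult_left_mono)
    have "euclid_norm ((1 / s) \<cdot>\<^sub>v x) \<le> 1" using s by (simp add: euclid_norm_smult s_def)
    then show "euclid_norm (M *\<^sub>v ((1 / s) \<cdot>\<^sub>v x)) \<le> spectral_norm M"
      using x by (intro euclid_norm_le_spectral_norm_unit) auto
  qed (use s in simp)
  finally show ?thesis by (simp add: s_def mult.commute)
qed

lemma entries_le_spectral_norm: "entries_le M (spectral_norm M)"
  unfolding entries_le_def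
proof (intro allI impI)
  fix i j assume ij: "i < dim_row M" "j < dim_col M"
  have "\<bar>M $$ (i, j)\<bar> = \<bar>(M *\<^sub>v unit_vec (dim_col M) j) $ i\<bar>"
    using ij by simp
  also have "\<dots> \<le> euclid_norm (M *\<^sub>v unit_vec (dim_col M) j)"
    using ij by (intro abs_entry_le_euclid_norm) simp
  also have "\<dots> \<le> spectral_norm M"
    using ij by (intro euclid_norm_le_spectral_norm_unit) (simp_all add: euclid_norm_def)
  finally show "\<bar>M $$ (i, j)\<bar> \<le> spectral_norm M" .
qed

section \<open>Matrices with Gram matrix near the identity\<close>

text \<open>Transfers \<open>near_orthonormal_columns\<close> to matrices: the operator bound
  required there is \<open>euclid_norm_mult_mat_vec\<close> for the Gram defect. The fact
  \<open>m \<le> n\<close> is delivered as well, so that later bounds can be expressed in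
  \<open>n\<close> alone.\<close>

lemma near_orthonormal_mat:
  assumes W: "W \<in> carrier_mat n m"
    and near: "spectral_norm (transpose_mat W * W - 1\<^sub>m m) \<le> d" and d: "d \<le> 1 / 2"
  obtains V where "V \<in> carrier_mat n m" "transpose_mat V * V = 1\<^sub>m m" "m \<le> n"
    "entries_le V 1" "entries_le (W - V) (2 * real m * d)"
proof -
  define w where "w k r = W $$ (r, k)" for k r
  define D where "D = transpose_mat W * W - 1\<^sub>m m"
  have D: "D \<in> carrier_mat m m" using W by (auto simp: D_def)
  have Dkp: "D $$ (k, p) = (\<Sum>r<n. w k r * w p r) - (if k = p then 1 else 0)"
    if "k < m" "p < m" for k p
    using W that by (auto simp: D_def w_def scalar_prod_def lessThan_atLeast0)
  have "L2_set (\<lambda>k. \<Sum>p<m. ((\<Sum>r<n. w k r * w p r) - (if k = p then 1 else 0)) * x p) {..<m}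
      \<le> d * L2_set x {..<m}" for x
  proof -
    have x: "euclid_norm (vec m x) = L2_set x {..<m}"
      by (simp add: euclid_norm_L2 cong: L2_set_cong_simp)
    have "L2_set (\<lambda>k. \<Sum>p<m. ((\<Sum>r<n. w k r * w p r) - (if k = p then 1 else 0)) * x p) {..<m}
        = euclid_norm (D *\<^sub>v vec m x)"
      unfolding euclid_norm_L2
      by (rule L2_set_cong) (use D in \<open>auto simp: Dkp scalar_prod_def lessThan_atLeast0\<close>)
    also have "\<dots> \<le> spectral_norm D * euclid_norm (vec m x)"
      using D by (intro euclid_norm_mult_mat_vec) auto
    also have "\<dots> \<le> d * L2_set x {..<m}"
      using near by (simp add: D_def x mult_right_mono)
    finally show ?thesis .
  qed
  from near_orthonormal_columns[where n = n and m = m and w = w and d = d, OF this d] obtain v where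
    orth: "\<And>i l. i < m \<Longrightarrow> l < m \<Longrightarrow> (\<Sum>r<n. v i r * v l r) = (if i = l then 1 else 0)" and
    close: "\<And>k r. k < m \<Longrightarrow> r < n \<Longrightarrow> \<bar>w k r - v k r\<bar> \<le> 2 * real m * d" by blast
  show thesis
  proof (rule that)
    show "mat n m (\<lambda>(r, k). v k r) \<in> carrier_mat n m" by simp
    show "transpose_mat (mat n m (\<lambda>(r, k). v k r)) * mat n m (\<lambda>(r, k). v k r) = 1\<^sub>m m"
      by (intro eq_matI) (auto simp: scalar_prod_def orth simp flip: lessThan_atLeast0)
    show "m \<le> n" using orth by (rule orthonormal_card_le)
    show "entries_le (mat n m (\<lambda>(r, k). v k r)) 1"
      by (auto simp: entries_le_def intro: orthonormal_entry_le[OF orth])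
    show "entries_le (W - mat n m (\<lambda>(r, k). v k r)) (2 * real m * d)"
      using W close by (auto simp: entries_le_def w_def)
  qed
qed

text \<open>Write \<open>y\<close> as G y - (G - I) y. The second term has at most half the norm of
  \<open>y\<close> and is absorbed on the left, so no inverse of \<open>G\<close> has to be
  formed.\<close>

lemma euclid_norm_le_near_identity:
  assumes G: "G \<in> carrier_mat m m" and near: "spectral_norm (G - 1\<^sub>m m) \<le> 1 / 2"
    and y: "y \<in> carrier_vec m"
  shows "euclid_norm y \<le> 2 * euclid_norm (G *\<^sub>v y)"
proof -
  define z where "z = (G - 1\<^sub>m m) *\<^sub>v y"
  have z: "z = G *\<^sub>v y - y"
    using G y by (simp add: z_def minus_mult_distrib_mat_vec[of G m m "1\<^sub>m m" y])
  have "euclid_norm y = L2_set (\<lambda>i. (G *\<^sub>v y) $ i + - z $ i) {..<m}"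
    unfolding euclid_norm_L2 using G y by (intro L2_set_cong) (auto simp: z)
  also have "\<dots> \<le> L2_set (\<lambda>i. (G *\<^sub>v y) $ i) {..<m} + L2_set (\<lambda>i. - z $ i) {..<m}"
    by (rule L2_set_triangle_ineq)
  also have "L2_set (\<lambda>i. (G *\<^sub>v y) $ i) {..<m} = euclid_norm (G *\<^sub>v y)"
    using G by (simp add: euclid_norm_L2)
  also have "L2_set (\<lambda>i. - z $ i) {..<m} = euclid_norm z"
    using G y by (simp add: euclid_norm_L2 L2_set_def z_def)
  also have "euclid_norm z \<le> spectral_norm (G - 1\<^sub>m m) * euclid_norm y"
    unfolding z_def using G y by (intro euclid_norm_mult_mat_vec) auto
  also have "\<dots> \<le> 1 / 2 * euclid_norm y"
    by (intro mult_right_mono near) (simp add: euclid_norm_L2)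
  finally show ?thesis by simp
qed

text \<open>Column by column application of the previous lemma; it serves to recover a bound on B
  from one on W^T W B.\<close>

lemma entries_le_near_identity_mult:
  assumes G: "G \<in> carrier_mat m m" and near: "spectral_norm (G - 1\<^sub>m m) \<le> 1 / 2"
    and B: "B \<in> carrier_mat m j" and GB: "entries_le (G * B) e"
  shows "entries_le B (2 * real m * e)"
  unfolding entries_le_def
proof (intro allI impI)
  fix p l assume "p < dim_row B" "l < dim_col B"
  then have pl: "p < m" "l < j" using B by auto
  have "\<bar>B $$ (p, l)\<bar> \<le> euclid_norm (col B l)"
    using abs_entry_le_euclid_norm[of p "col B l"] pl B by simp
  also have "\<dots> \<le> 2 * euclid_norm (G *\<^sub>v col B l)"
    by (rule euclid_norm_le_near_identity[OF G near]) (use pl B in auto)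
  also have "euclid_norm (G *\<^sub>v col B l) \<le> real m * e"
    using euclid_norm_le_entries[of "G *\<^sub>v col B l" e] GB G B pl by (auto simp: entries_le_def)
  finally show "\<bar>B $$ (p, l)\<bar> \<le> 2 * real m * e" by simp
qed

section \<open>Appending and splitting off a column\<close>

lemma append_col_carrier:
  assumes "Q \<in> carrier_mat n j"
  shows "append_col Q q \<in> carrier_mat n (j + 1)"
  using assms by (auto simp: append_col_def)

lemma append_col_index:
  assumes "Q \<in> carrier_mat n j" "q \<in> carrier_vec n" "r < n" "k < j + 1"
  shows "append_col Q q $$ (r, k) = (if k < j then Q $$ (r, k) else q $ r)"
  using assms by (auto simp: append_col_def mat_of_cols_index nth_append less_Suc_eq)

text \<open>Stacking \<open>b\<close> as a last row under \<open>T\<close> merges the two terms of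
  the decomposition into one product, so that the computed and the orthonormal basis can each be
  handled as one matrix with \<open>j + 1\<close> columns.\<close>

lemma append_col_mult:
  assumes "Q \<in> carrier_mat n j" "q \<in> carrier_vec n" "T \<in> carrier_mat j l" "b \<in> carrier_vec l"
  shows "append_col Q q * mat (j + 1) l (\<lambda>(p, k). if p < j then T $$ (p, k) else b $ k)
    = Q * T + outer_product q b"
proof (rule eq_matI)
  fix r k assume "r < dim_row (Q * T + outer_product q b)" "k < dim_col (Q * T + outer_product q b)"
  then have rk: "r < n" "k < l" using assms by (auto simp: outer_product_def)
  then show "(append_col Q q * mat (j + 1) l (\<lambda>(p, k). if p < j then T $$ (p, k) else b $ k)) $$ (r, k)
      = (Q * T + outer_product q b) $$ (r, k)"
    using assms append_col_carrier[OF assms(1), of q]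
    by (simp add: scalar_prod_def outer_product_def append_col_index[OF assms(1,2)]
        flip: lessThan_atLeast0)
qed (use assms append_col_carrier[OF assms(1), of q] in \<open>auto simp: outer_product_def\<close>)

lemma append_col_split:
  assumes "V \<in> carrier_mat n (j + 1)"
  shows "append_col (mat n j (\<lambda>(r, k). V $$ (r, k))) (col V j) = V"
proof (rule eq_matI)
  let ?Q = "mat n j (\<lambda>(r, k). V $$ (r, k))"
  have Q: "?Q \<in> carrier_mat n j" "col V j \<in> carrier_vec n" using assms by auto
  show "dim_row (append_col ?Q (col V j)) = dim_row V" "dim_col (append_col ?Q (col V j)) = dim_col V"
    using append_col_carrier[OF Q(1)] assms by auto
  show "append_col ?Q (col V j) $$ (r, k) = V $$ (r, k)" if "r < dim_row V" "k < dim_col V" for r k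
    using that assms by (subst append_col_index[OF Q]) (auto simp: less_Suc_eq)
qed

lemma orthonormal_columnsI:
  assumes "transpose_mat V * V = 1\<^sub>m (dim_col V)"
  shows "orthonormal_columns V"
proof -
  have "scalar_prod (col V r) (col V s) = (transpose_mat V * V) $$ (r, s)"
    if "r < dim_col V" "s < dim_col V" for r s
    using that by simp
  then show ?thesis by (auto simp: orthonormal_columns_def assms)
qed

section \<open>The perturbed decomposition and its residual\<close>

text \<open>In the application \<open>X\<close> and \<open>W\<close> are the computed bases, without
  and with the last vector, and \<open>Q\<close> and \<open>V\<close> their orthonormal
  counterparts. \<open>P\<close> is the orthogonal projection of \<open>F\<close> onto the range of
  \<open>V\<close>, and substituting \<open>AX\<close> shows that \<open>K\<close> is exactly the
  defect A Q - V B - (F - P). As Q^T Q = I, multiplying K Q^T by \<open>Q\<close> gives back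
  \<open>K\<close>, so subtracting K Q^T from \<open>A\<close> cancels the defect.\<close>

lemma residual_identity:
  fixes A Q X V W B F :: "real mat"
  assumes A: "A \<in> carrier_mat n n" and Q: "Q \<in> carrier_mat n j" and X: "X \<in> carrier_mat n j"
    and V: "V \<in> carrier_mat n m" and W: "W \<in> carrier_mat n m"
    and B: "B \<in> carrier_mat m j" and F: "F \<in> carrier_mat n j"
    and orth: "transpose_mat V * V = 1\<^sub>m m" "transpose_mat Q * Q = 1\<^sub>m j"
    and AX: "A * X = W * B + F"
  defines "P \<equiv> V * (transpose_mat V * F)"
  defines "K \<equiv> P + A * (Q - X) - (V - W) * B"
  shows "(A + - (K * transpose_mat Q)) * Q = V * B + (F - P)"
    and "transpose_mat V * (F - P) = 0\<^sub>m m j"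
proof -
  have P: "P \<in> carrier_mat n j" using V F by (auto simp: P_def)
  have K: "K \<in> carrier_mat n j" using P A Q X V W B by (auto simp: K_def)
  have KQ: "K * transpose_mat Q \<in> carrier_mat n n" using K Q by auto
  have Qt: "transpose_mat Q \<in> carrier_mat j n" and Vt: "transpose_mat V \<in> carrier_mat m n"
    using Q V by auto
  have "K * transpose_mat Q * Q = K"
    using assoc_mult_mat[OF K Qt Q] right_mult_one_mat[OF K] orth(2) by simp
  moreover have "- (K * transpose_mat Q) * Q = - (K * transpose_mat Q * Q)"
    by (rule uminus_mult_left_mat) (use Q in auto)
  ultimately have "(A + - (K * transpose_mat Q)) * Q = A * Q + - K"
    using add_mult_distrib_mat[OF A uminus_carrier_mat[OF KQ] Q] by simp
  also have "\<dots> = V * B + (F - P)"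
  proof -
    have "K = P + (A * Q - A * X) - (V * B - W * B)"
      unfolding K_def using mult_minus_distrib_mat[OF A Q X] minus_mult_distrib_mat[OF V W B] by simp
    then have "K = P + (A * Q - (W * B + F)) - (V * B - W * B)" by (simp add: AX)
    then show ?thesis using A Q V W B P F by (intro eq_matI) auto
  qed
  finally show "(A + - (K * transpose_mat Q)) * Q = V * B + (F - P)" .
  have VF: "transpose_mat V * F \<in> carrier_mat m j" using V F by auto
  have "transpose_mat V * P = transpose_mat V * F"
    using assoc_mult_mat[OF Vt V VF] left_mult_one_mat[OF VF] orth(1) by (simp add: P_def)
  then show "transpose_mat V * (F - P) = 0\<^sub>m m j"
    using mult_minus_distrib_mat[OF Vt F P] VF by auto
qed

text \<open>The factor \<open>d\<close> has to appear in every term, although \<open>B\<close> and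
  \<open>F\<close> are only of order \<open>a\<close>. In \<open>K\<close> it comes from the
  differences of the bases, and in \<open>P\<close> from W^T F and from the difference W - V. Each
  matrix product raises the power of \<open>n\<close> by one.\<close>

lemma residual_bounds:
  fixes A Q X V W B F :: "real mat"
  assumes A: "A \<in> carrier_mat n n" and Q: "Q \<in> carrier_mat n j" and X: "X \<in> carrier_mat n j"
    and V: "V \<in> carrier_mat n m" and W: "W \<in> carrier_mat n m"
    and B: "B \<in> carrier_mat m j" and F: "F \<in> carrier_mat n j"
    and dims: "0 < m" "m \<le> n" "j \<le> n"
    and AX: "A * X = W * B + F"
    and near: "spectral_norm (transpose_mat W * W - 1\<^sub>m m) \<le> 1 / 2"
    and d: "0 \<le> d" "d \<le> 1 / 2" and a: "0 \<le> a"
    and bA: "entries_le A a" and bV: "entries_le V 1" and bQ: "entries_le Q 1"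
    and bD: "entries_le (W - V) (2 * real n * d)" and bDQ: "entries_le (X - Q) (2 * real n * d)"
    and bWF: "entries_le (transpose_mat W * F) (d * a)"
  defines "P \<equiv> V * (transpose_mat V * F)"
  defines "K \<equiv> P + A * (Q - X) - (V - W) * B"
  shows "entries_le P (67 * real n ^ 10 * (d * a))"
    and "entries_le (K * transpose_mat Q) (67 * real n ^ 11 * (d * a))"
proof -
  define N where "N = real n"
  have N: "N \<ge> 1" using dims by (simp add: N_def)
  \<comment> \<open>Since \<open>N \<ge> 1\<close>, lower powers can be raised to the highest one
    present, which collects each sum below into a single monomial.\<close>
  have pw: "N ^ k * t \<le> N ^ l * t" if "k \<le> l" "0 \<le> t" for k l t
    using N that by (intro mult_right_mono power_increasing) auto
  have da: "0 \<le> d * a" "d * a \<le> a" using d a by (auto intro: mult_left_le_one_le)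
  have Nk: "0 \<le> N ^ k" for k using N by simp
  have nn: "0 \<le> N ^ k * a" "0 \<le> N ^ k * (d * a)" "0 \<le> N ^ k * d" for k
    using Nk a da d by simp_all
  have "N * d \<le> N * (1 / 2)" using mult_left_mono[OF d(2), of N] N by simp
  \<comment> \<open>As \<open>2 * N * d\<close> is at most \<open>N\<close>, the entries of
    \<open>W\<close> and \<open>X\<close>, each within this of an entry at most 1, stay below
    \<open>2 * N\<close>.\<close>
  then have W1: "1 + 2 * N * d \<le> 2 * N" using N by linarith
  have "V + (W - V) = W" "Q + (X - Q) = X" using V W Q X by auto
  then have bW: "entries_le W (2 * N)" and bX: "entries_le X (2 * N)"
    using entries_le_mono[OF entries_le_add[OF V minus_carrier_mat[OF V] bV bD], of "2 * N"]
      entries_le_mono[OF entries_le_add[OF Q minus_carrier_mat[OF Q] bQ bDQ], of "2 * N"] W1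
    by (simp_all add: N_def)
  have AXc: "A * X \<in> carrier_mat n j" "W * B \<in> carrier_mat n j"
    and WW: "transpose_mat W * W \<in> carrier_mat m m" using A X W B by auto
  have Wt: "transpose_mat W \<in> carrier_mat m n" and Vt: "transpose_mat V \<in> carrier_mat m n"
    and Qt: "transpose_mat Q \<in> carrier_mat j n" using W V Q by auto
  have bAX: "entries_le (A * X) (2 * (N ^ 2 * a))"
    using entries_le_mult[OF A X bA bX order_refl a] N
    by (simp add: N_def power2_eq_square mult_ac)
  have bWAX: "entries_le (transpose_mat W * (A * X)) (4 * (N ^ 4 * a))"
    using entries_le_mult[OF Wt AXc(1) entries_le_transpose[OF bW] bAX order_refl] N a d
    by (simp add: N_def mult_ac numeral_eq_Suc mult_nonneg_nonneg)
  \<comment> \<open>Multiplying by W^T gives the normal equations for \<open>B\<close>, whose matrix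
    W^T W is near the identity.\<close>
  have "A * X - F = W * B" unfolding AX using W B F by (intro eq_matI) auto
  then have WWB: "transpose_mat W * (A * X) - transpose_mat W * F = transpose_mat W * W * B"
    using assoc_mult_mat[OF Wt W B] mult_minus_distrib_mat[OF Wt AXc(1) F] by simp
  have bWWB: "entries_le (transpose_mat W * (A * X) - transpose_mat W * F) (4 * (N ^ 4 * a) + d * a)"
    by (rule entries_le_minus[OF _ _ bWAX bWF]) (use Wt AXc F in auto)
  have "4 * (N ^ 4 * a) + d * a \<le> 5 * (N ^ 4 * a)"
    using pw[OF _ a, of 0 4, simplified] da by linarith
  from entries_le_mono[OF bWWB[unfolded WWB] this]
  have "entries_le (transpose_mat W * W * B) (5 * (N ^ 4 * a))" .
  from entries_le_near_identity_mult[OF WW near B this]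
  have "entries_le B (2 * real m * (5 * (N ^ 4 * a)))" .
  then have "entries_le B (2 * N * (5 * (N ^ 4 * a)))"
    by (rule entries_le_mono) (use dims a in \<open>auto simp: N_def intro!: mult_right_mono\<close>)
  then have bB: "entries_le B (10 * (N ^ 5 * a))"
    by (simp add: mult_ac numeral_eq_Suc)
  have bWB: "entries_le (W * B) (20 * (N ^ 7 * a))"
    using entries_le_mult[OF W B bW bB dims(2)] N a d
    by (simp add: N_def mult_ac numeral_eq_Suc mult_nonneg_nonneg)
  have AXF: "A * X - W * B = F" unfolding AX using W B F by (intro eq_matI) auto
  have "2 * (N ^ 2 * a) + 20 * (N ^ 7 * a) \<le> 22 * (N ^ 7 * a)"
    using pw[OF _ a, of 2 7, simplified] by linarith
  from entries_le_mono[OF entries_le_minus[OF AXc bAX bWB, unfolded AXF] this]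
  have bF: "entries_le F (22 * (N ^ 7 * a))" .
  have WVt: "transpose_mat (W - V) \<in> carrier_mat m n" using W V by auto
  have bDF: "entries_le (transpose_mat (W - V) * F) (44 * (N ^ 9 * (d * a)))"
    using entries_le_mult[OF WVt F entries_le_transpose[OF bD] bF order_refl] N a d
    by (simp add: N_def mult_ac numeral_eq_Suc mult_nonneg_nonneg)
  have WF: "transpose_mat W * F \<in> carrier_mat m j" and DF: "transpose_mat (W - V) * F \<in> carrier_mat m j"
    and VF: "transpose_mat V * F \<in> carrier_mat m j"
    using W V F by auto
  \<comment> \<open>V^T F is W^T F, small by assumption, minus (W - V)^T F, where the difference of
    the bases supplies the factor \<open>d\<close>.\<close>
  have "transpose_mat W - transpose_mat (W - V) = transpose_mat V" using W V by auto
  then have VFeq: "transpose_mat W * F - transpose_mat (W - V) * F = transpose_mat V * F"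
    using minus_mult_distrib_mat[OF Wt WVt F] by simp
  have "d * a + 44 * (N ^ 9 * (d * a)) \<le> 45 * (N ^ 9 * (d * a))"
    using pw[OF _ da(1), of 0 9, simplified] by linarith
  from entries_le_mono[OF entries_le_minus[OF WF DF bWF bDF, unfolded VFeq] this]
  have bVF: "entries_le (transpose_mat V * F) (45 * (N ^ 9 * (d * a)))" .
  have Pc: "P \<in> carrier_mat n j" using V VF by (auto simp: P_def)
  have bP: "entries_le P (45 * (N ^ 10 * (d * a)))"
    using entries_le_mult[OF V VF bV bVF dims(2)] N a d
    by (simp add: P_def N_def mult_ac numeral_eq_Suc mult_nonneg_nonneg)
  then show "entries_le P (67 * real n ^ 10 * (d * a))"
    by (rule entries_le_mono) (use nn(2)[of 10] in \<open>unfold N_def, linarith\<close>)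
  have "Q - X = - (X - Q)" "V - W = - (W - V)" using Q X V W by auto
  then have bD': "entries_le (Q - X) (2 * (N * d))" "entries_le (V - W) (2 * (N * d))"
    using entries_le_uminus[OF bDQ] entries_le_uminus[OF bD] by (simp_all add: N_def mult_ac)
  have c: "Q - X \<in> carrier_mat n j" "V - W \<in> carrier_mat n m" using Q X V W by auto
  have c': "A * (Q - X) \<in> carrier_mat n j" "(V - W) * B \<in> carrier_mat n j" using A c B by auto
  have b1: "entries_le (A * (Q - X)) (2 * (N ^ 2 * (d * a)))"
    using entries_le_mult[OF A c(1) bA bD'(1) order_refl a] N a d
    by (simp add: N_def mult_ac numeral_eq_Suc mult_nonneg_nonneg)
  have b2: "entries_le ((V - W) * B) (20 * (N ^ 7 * (d * a)))"
    using entries_le_mult[OF c(2) B bD'(2) bB dims(2)] N a d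
    by (simp add: N_def mult_ac numeral_eq_Suc mult_nonneg_nonneg)
  have PA: "P + A * (Q - X) \<in> carrier_mat n j" using Pc c' by auto
  have Kc: "K \<in> carrier_mat n j" unfolding K_def by (rule minus_carrier_mat[OF c'(2)])
  \<comment> \<open>The constant 67 is 45 + 2 + 20 once all three powers are raised to 10.\<close>
  have "entries_le K (45 * (N ^ 10 * (d * a)) + 2 * (N ^ 2 * (d * a)) + 20 * (N ^ 7 * (d * a)))"
    unfolding K_def by (rule entries_le_minus[OF PA c'(2) entries_le_add[OF Pc c'(1) bP b1] b2])
  then have bK: "entries_le K (67 * (N ^ 10 * (d * a)))"
    by (rule entries_le_mono) (use pw[OF _ da(1), of 2 10, simplified] pw[OF _ da(1), of 7 10, simplified] in linarith)
  show "entries_le (K * transpose_mat Q) (67 * real n ^ 11 * (d * a))"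
    using entries_le_mult[OF Kc Qt bK entries_le_transpose[OF bQ] dims(3)] N a d
    by (simp add: N_def mult_ac numeral_eq_Suc mult_nonneg_nonneg)
qed

section \<open>Growth of the constant and assembly of the theorem\<close>

lemma polynomial_growth_mult_abs:
  assumes "polynomial_growth c"
  shows "polynomial_growth (\<lambda>n. C * real n ^ l * \<bar>c n\<bar>)"
proof -
  obtain k where "c \<in> O(\<lambda>n. real n ^ k)" using assms by (auto simp: polynomial_growth_def)
  then have "(\<lambda>n. C * real n ^ l * \<bar>c n\<bar>) \<in> O(\<lambda>n. real n ^ l * real n ^ k)"
    by (intro landau_o.big.mult) auto
  then show ?thesis by (auto simp: polynomial_growth_def power_add[symmetric])
qed

text \<open>\<open>C\<close> depends on \<open>n\<close> and \<open>c n\<close> only. Its exponent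
  13 is the worst entrywise exponent 11 plus 2 for the passage from entries to the spectral
  norm.\<close>

lemma orthonormal_krylov_like:
  fixes c :: "nat \<Rightarrow> real" and A :: "real mat"
  assumes u: "u > 0" "c n * u \<le> 1 / 2"
    and stable: "stable_krylov_like c u n j A Qh Th qh bh Fh"
  defines "C \<equiv> 67 * real n ^ 13 * \<bar>c n\<bar>"
  obtains Q q E F where
    "Q \<in> carrier_mat n j" "q \<in> carrier_vec n" "E \<in> carrier_mat n n" "F \<in> carrier_mat n j"
    "orthonormal_columns (append_col Q q)"
    "spectral_norm (append_col Qh qh - append_col Q q) \<le> C * u"
    "spectral_norm E \<le> C * (spectral_norm A * u)"
    "(A + E) * Q = Q * Th + outer_product q bh + F"
    "transpose_mat (append_col Q q) * F = 0\<^sub>m (j + 1) j"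
    "spectral_norm (Fh - F) \<le> C * (spectral_norm A * u)"
proof -
  define W where "W = append_col Qh qh"
  define d where "d = c n * u"
  define a where "a = spectral_norm A"
  define B where "B = mat (j + 1) j (\<lambda>(p, k). if p < j then Th $$ (p, k) else bh $ k)"
  have A: "A \<in> carrier_mat n n" and Qh: "Qh \<in> carrier_mat n j" and Th: "Th \<in> carrier_mat j j"
    and qh: "qh \<in> carrier_vec n" and bh: "bh \<in> carrier_vec j" and Fh: "Fh \<in> carrier_mat n j"
    and AQ: "A * Qh = Qh * Th + outer_product qh bh + Fh"
    and near: "spectral_norm (transpose_mat W * W - 1\<^sub>m (j + 1)) \<le> d"
    and WF: "spectral_norm (transpose_mat W * Fh) \<le> c n * (a * u)"
    using stable by (auto simp: stable_krylov_like_def W_def d_def a_def)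
  have W: "W \<in> carrier_mat n (j + 1)" using append_col_carrier[OF Qh] by (simp add: W_def)
  have B: "B \<in> carrier_mat (j + 1) j" by (simp add: B_def)
  \<comment> \<open>\<open>d\<close> dominates a spectral norm and is therefore nonnegative; with
    \<open>u > 0\<close> this forces \<open>c n\<close> to be nonnegative, which removes the
    absolute value in \<open>C\<close>.\<close>
  have d: "0 \<le> d" "d \<le> 1 / 2" using order_trans[OF spectral_norm_nonneg near] u by (simp_all add: d_def)
  have a: "0 \<le> a" by (simp add: a_def spectral_norm_nonneg)
  have cn: "0 \<le> c n" using d u by (simp add: d_def zero_le_mult_iff)
  obtain V where V: "V \<in> carrier_mat n (j + 1)" and VV: "transpose_mat V * V = 1\<^sub>m (j + 1)"
    and m: "j + 1 \<le> n" and bV: "entries_le V 1" and bD': "entries_le (W - V) (2 * real (j + 1) * d)"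
    using near_orthonormal_mat[OF W near d(2)] .
  \<comment> \<open>An orthonormal V with \<open>j + 1\<close> columns forces
    \<open>j + 1 \<le> n\<close>, which turns the bound into one in \<open>n\<close>.\<close>
  have bD: "entries_le (W - V) (2 * real n * d)"
    by (rule entries_le_mono[OF bD']) (use m d in \<open>intro mult_right_mono; simp\<close>)
  define Q where "Q = mat n j (\<lambda>(r, k). V $$ (r, k))"
  define q where "q = col V j"
  have Q: "Q \<in> carrier_mat n j" and q: "q \<in> carrier_vec n" using V by (auto simp: Q_def q_def)
  have QV: "append_col Q q = V" unfolding Q_def q_def by (rule append_col_split[OF V])
  have QQ: "transpose_mat Q * Q = 1\<^sub>m j"
  proof (rule eq_matI)
    fix r s assume "r < dim_row (1\<^sub>m j)" "s < dim_col (1\<^sub>m j)"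
    then have rs: "r < j" "s < j" by auto
    have "(transpose_mat Q * Q) $$ (r, s) = (transpose_mat V * V) $$ (r, s)"
      using rs V by (simp add: Q_def scalar_prod_def)
    then show "(transpose_mat Q * Q) $$ (r, s) = 1\<^sub>m j $$ (r, s)" using rs VV by simp
  qed (use Q in auto)
  have bQ: "entries_le Q 1" using bV V by (auto simp: entries_le_def Q_def)
  have bDQ: "entries_le (Qh - Q) (2 * real n * d)"
    unfolding entries_le_def
  proof (intro allI impI)
    fix r k assume "r < dim_row (Qh - Q)" "k < dim_col (Qh - Q)"
    then have rk: "r < n" "k < j" using Q by auto
    then have "(Qh - Q) $$ (r, k) = (W - V) $$ (r, k)"
      using Qh V W append_col_index[OF Qh qh, of r k] by (simp add: Q_def W_def)
    then show "\<bar>(Qh - Q) $$ (r, k)\<bar> \<le> 2 * real n * d"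
      using bD rk V W by (simp add: entries_le_def)
  qed
  have WB: "W * B = Qh * Th + outer_product qh bh" unfolding W_def B_def by (rule append_col_mult[OF Qh qh Th bh])
  have VB: "V * B = Q * Th + outer_product q bh" unfolding QV[symmetric] B_def by (rule append_col_mult[OF Q q Th bh])
  have AX: "A * Qh = W * B + Fh" by (simp add: WB AQ)
  define P where "P = V * (transpose_mat V * Fh)"
  define K where "K = P + A * (Q - Qh) - (V - W) * B"
  have Pc: "P \<in> carrier_mat n j" using V Fh by (auto simp: P_def)
  have KQ: "K * transpose_mat Q \<in> carrier_mat n n" using Pc A Q Qh V W B by (auto simp: K_def)
  note id = residual_identity[OF A Q Qh V W B Fh VV QQ AX, folded P_def, folded K_def]
  have bWF: "entries_le (transpose_mat W * Fh) (d * a)"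
    by (rule entries_le_mono[OF entries_le_spectral_norm]) (use WF in \<open>simp add: d_def mult_ac\<close>)
  have near': "spectral_norm (transpose_mat W * W - 1\<^sub>m (j + 1)) \<le> 1 / 2" using near d by simp
  have bA: "entries_le A a" unfolding a_def by (rule entries_le_spectral_norm)
  have "0 < j + 1" "j \<le> n" using m by auto
  note bounds = residual_bounds[OF A Q Qh V W B Fh this(1) m this(2) AX near' d a bA bV bQ bD bDQ bWF,
      folded P_def, folded K_def]
  \<comment> \<open>All three final norm bounds go through this one conversion, with the exponent
    raised to 11 and both dimensions bounded by \<open>n\<close>.\<close>
  have spec: "spectral_norm M \<le> 67 * real n ^ 13 * t"
    if M: "M \<in> carrier_mat n s" "s \<le> n" and e: "entries_le M (67 * real n ^ k * t)" and k: "k \<le> 11" and t: "0 \<le> t"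
    for M s k t
  proof -
    have n1: "1 \<le> real n" using m by simp
    have "spectral_norm M \<le> real n * (real s * (67 * real n ^ k * t))"
      using spectral_norm_le_entries[OF e] M(1) by simp
    also have "\<dots> \<le> real n * (real n * (67 * real n ^ 11 * t))"
      using M(2) k t n1 by (intro mult_mono power_increasing) auto
    also have "\<dots> = 67 * real n ^ 13 * t" by (simp add: numeral_eq_Suc)
    finally show ?thesis .
  qed
  have Ct: "C * (a * u) = 67 * real n ^ 13 * (d * a)" "C * u = 67 * real n ^ 13 * d"
    using cn by (simp_all add: C_def d_def)
  \<comment> \<open>The witnesses are the first \<open>j\<close> columns of \<open>V\<close>, its
    last column, \<open>E = - (K * transpose_mat Q)\<close> and \<open>F = Fh - P\<close>; thus the
    change in the residual is exactly \<open>P\<close>.\<close>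
  show thesis
  proof (rule that)
    show "Q \<in> carrier_mat n j" "q \<in> carrier_vec n" by fact+
    show "- (K * transpose_mat Q) \<in> carrier_mat n n" using KQ by simp
    show "Fh - P \<in> carrier_mat n j" using Pc by auto
    show "orthonormal_columns (append_col Q q)" unfolding QV using V VV by (intro orthonormal_columnsI) auto
    show "spectral_norm (append_col Qh qh - append_col Q q) \<le> C * u"
      unfolding QV W_def[symmetric] Ct
    proof (rule spec)
      show "entries_le (W - V) (67 * real n ^ 1 * d)"
        using d by (intro entries_le_mono[OF bD]) (simp add: mult_right_mono)
    qed (use V m d in auto)
    show "spectral_norm (- (K * transpose_mat Q)) \<le> C * (spectral_norm A * u)"
      unfolding a_def[symmetric] Ct
      by (rule spec[OF _ order_refl entries_le_uminus[OF bounds(2)]]) (use KQ d a in auto)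
    show "(A + - (K * transpose_mat Q)) * Q = Q * Th + outer_product q bh + (Fh - P)"
      using id(1) by (simp add: VB)
    show "transpose_mat (append_col Q q) * (Fh - P) = 0\<^sub>m (j + 1) j" using id(2) by (simp add: QV)
    have "Fh - (Fh - P) = P" using Fh Pc by auto
    then show "spectral_norm (Fh - (Fh - P)) \<le> C * (spectral_norm A * u)"
      unfolding a_def[symmetric] Ct using spec[OF Pc _ bounds(1)] m d a by simp
  qed
qed

theorem theorem2p8:
  fixes c :: "nat \<Rightarrow> real"
  assumes "polynomial_growth c"
  shows "\<exists>c' :: nat \<Rightarrow> real. polynomial_growth c' \<and>
    (\<forall>(n::nat) (j::nat) (u::real) A Qh Th qh bh Fh.
       u > 0 \<longrightarrow> c n * u \<le> 1 / 2 \<longrightarrow>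
       A \<in> carrier_mat n n \<longrightarrow> transpose_mat A = A \<longrightarrow>
       stable_krylov_like c u n j A Qh Th qh bh Fh \<longrightarrow>
       (\<exists>Q q E F.
          Q \<in> carrier_mat n j \<and> q \<in> carrier_vec n \<and>
          E \<in> carrier_mat n n \<and> F \<in> carrier_mat n j \<and>
          orthonormal_columns (append_col Q q) \<and>
          spectral_norm (append_col Qh qh - append_col Q q) \<le> c' n * u \<and>
          spectral_norm E \<le> c' n * (spectral_norm A * u) \<and>
          (A + E) * Q = Q * Th + outer_product q bh + F \<and>
          transpose_mat (append_col Q q) * F = 0\<^sub>m (j + 1) j \<and>
          spectral_norm (Fh - F) \<le> c' n * (spectral_norm A * u)))"
\<comment> \<open>The witness for \<open>c'\<close> stays schematic until the first
  \<open>show\<close> fixes it, before any dimension or matrix is introduced.\<close>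
proof (rule exI, rule conjI)
  show "polynomial_growth (\<lambda>n. 67 * real n ^ 13 * \<bar>c n\<bar>)"
    by (rule polynomial_growth_mult_abs[OF assms])
qed (intro allI impI, rule orthonormal_krylov_like, assumption+, blast)

end
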